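(* Let $(M,J,g)$ be an almost complex manifold with Norden metric and let $\tilde g(x,y)=g(Jx,y)$ be its associated Norden metric. The Nijenhuis tensor is invariant and the associated Nijenhuis tensor is anti-invariant under the twin interchange, i.e. for all vector fields $x,y$ $$[J,J](x,y)=\widetilde{[J,J]}(x,y),\qquad \{J,J\}(x,y)=-\widetilde{\{J,J\}}(x,y),$$ where $[J,J]$, $\{J,J\}$ are the tensors of $(M,J,g)$ and $\widetilde{[J,J]}$, $\widetilde{\{J,J\}}$ are the corresponding tensors of $(M,J,\tilde g)$.
   Context: An almost complex manifold with Norden metric $(M,J,g)$ is a $2n$-dimensional manifold with $J^2=-I$ and a pseudo-Riemannian metric $g$ with $g(Jx,Jy)=-g(x,y)$. The associated metric $\tilde g(x,y)=g(Jx,y)$ is again a Norden metric, so $(M,J,\tilde g)$ is also of this type. Let $D$ and $\tilde D$ be the Levi-Civita connections of $g$ and $\tilde g$; the twin interchange is the interchange of $D$ and $\tilde D$ (and of $g$ and $\tilde g$). The Nijenhuis tensor is $[J,J](x,y)=[Jx,Jy]-[x,y]-J[Jx,y]-J[x,Jy]$, with $[x,y]=D_xy-D_yx$ the Lie bracket. The associated Nijenhuis tensor of $(M,J,g)$ is the symmetric $(1,2)$-tensor $\{J,J\}(x,y)=\{Jx,Jy\}-\{x,y\}-J\{Jx,y\}-J\{x,Jy\}$, where $\{x,y\}=D_xy+D_yx$. The tilded tensors are defined by the same formulas with $D$ replaced by $\tilde D$. *)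

theory Defs
  imports "HOL-Analysis.Analysis" "HOL-Library.Function_Algebras"
begin

section \<open>Smooth manifolds\<close>

primrec C_on :: "nat \<Rightarrow> 'a::real_normed_vector set \<Rightarrow> ('a \<Rightarrow> 'b::real_normed_vector) \<Rightarrow> bool"
  where
    "C_on 0 S f \<longleftrightarrow> continuous_on S f"
  | "C_on (Suc k) S f \<longleftrightarrow> (\<forall>x\<in>S. f differentiable (at x)) \<and>
       (\<forall>v. C_on k S (\<lambda>x. frechet_derivative f (at x) v))"

text \<open>Meant for open \<open>S\<close>, since the derivatives are taken at \<open>at x\<close>.\<close>

definition smooth_on :: "'a::real_normed_vector set \<Rightarrow> ('a \<Rightarrow> 'b::real_normed_vector) \<Rightarrow> bool"
  where "smooth_on S f \<longleftrightarrow> (\<forall>k. C_on k S f)"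

text \<open>The manifold is the whole type \<open>'a\<close>, whose type classes make it Hausdorff and second
  countable; it is modelled on the Euclidean space \<open>'e\<close>. A chart is a pair of its domain and
  its coordinate map; the values of the coordinate map outside the domain are irrelevant.\<close>

type_synonym ('a, 'e) chart = "'a set \<times> ('a \<Rightarrow> 'e)"

definition is_chart :: "('a::topological_space, 'e::euclidean_space) chart \<Rightarrow> bool"
  where "is_chart = (\<lambda>(U, \<phi>). open U \<and> open (\<phi> ` U) \<and>
           homeomorphism U (\<phi> ` U) \<phi> (inv_into U \<phi>))"

definition smooth_atlas ::
    "('a::{t2_space,second_countable_topology}, 'e::euclidean_space) chart set \<Rightarrow> bool"
  where "smooth_atlas A \<longleftrightarrow>
    (\<forall>c\<in>A. is_chart c) \<and>
    (\<Union>c\<in>A. fst c) = UNIV \<and>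
    (\<forall>(U, \<phi>)\<in>A. \<forall>(V, \<psi>)\<in>A. smooth_on (\<phi> ` (U \<inter> V)) (\<psi> \<circ> inv_into U \<phi>))"

definition smooth_fun ::
    "('a::topological_space, 'e::euclidean_space) chart set \<Rightarrow> ('a \<Rightarrow> real) \<Rightarrow> bool"
  where "smooth_fun A f \<longleftrightarrow> (\<forall>(U, \<phi>)\<in>A. smooth_on (\<phi> ` U) (f \<circ> inv_into U \<phi>))"

section \<open>Tangent vectors and vector fields\<close>

text \<open>A tangent vector is a directional derivative, i.e. a functional on smooth functions; it is
  set to 0 on all other functions, so that equality of tangent vectors is equality of functionals.
  Sums, differences and negatives of tangent vectors and of vector fields are the pointwise ones
  of \<open>Function_Algebras\<close>.\<close>

type_synonym 'a tvec = "('a \<Rightarrow> real) \<Rightarrow> real"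
type_synonym 'a vfield = "'a \<Rightarrow> 'a tvec"

text \<open>\<open>coord_vector A (U, \<phi>) p e\<close> is \<open>\<Sum>i. e\<^sub>i \<partial>/\<partial>x\<^sub>i\<close> at \<open>p\<close>, in the coordinates
  of the chart \<open>(U, \<phi>)\<close>.\<close>

definition coord_vector ::
    "('a::topological_space, 'e::euclidean_space) chart set \<Rightarrow> ('a, 'e) chart \<Rightarrow> 'a \<Rightarrow> 'e \<Rightarrow> 'a tvec"
  where "coord_vector A = (\<lambda>(U, \<phi>) p e f.
    if smooth_fun A f then frechet_derivative (f \<circ> inv_into U \<phi>) (at (\<phi> p)) e else 0)"

definition tangent_space ::
    "('a::topological_space, 'e::euclidean_space) chart set \<Rightarrow> 'a \<Rightarrow> 'a tvec set"
  where "tangent_space A p = {coord_vector A c p e | c e. c \<in> A \<and> p \<in> fst c}"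

definition tscale :: "real \<Rightarrow> 'a tvec \<Rightarrow> 'a tvec"
  where "tscale c v = (\<lambda>f. c * v f)"

definition vscale :: "('a \<Rightarrow> real) \<Rightarrow> 'a vfield \<Rightarrow> 'a vfield"
  where "vscale h X = (\<lambda>p. tscale (h p) (X p))"

definition vapply :: "'a vfield \<Rightarrow> ('a \<Rightarrow> real) \<Rightarrow> ('a \<Rightarrow> real)"
  where "vapply X f = (\<lambda>p. X p f)"

definition vector_fields ::
    "('a::topological_space, 'e::euclidean_space) chart set \<Rightarrow> 'a vfield set"
  where "vector_fields A =
    {X. (\<forall>p. X p \<in> tangent_space A p) \<and> (\<forall>f. smooth_fun A f \<longrightarrow> smooth_fun A (vapply X f))}"

definition lie_bracket ::
    "('a::topological_space, 'e::euclidean_space) chart set \<Rightarrow> 'a vfield \<Rightarrow> 'a vfield \<Rightarrow> 'a vfield"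
  where "lie_bracket A X Y = (\<lambda>p f.
    if smooth_fun A f then X p (vapply Y f) - Y p (vapply X f) else 0)"

section \<open>Tensor fields and connections\<close>

type_synonym 'a endo_field = "'a \<Rightarrow> 'a tvec \<Rightarrow> 'a tvec"
type_synonym 'a bilin_field = "'a \<Rightarrow> 'a tvec \<Rightarrow> 'a tvec \<Rightarrow> real"

definition endo :: "'a endo_field \<Rightarrow> 'a vfield \<Rightarrow> 'a vfield"
  where "endo J X = (\<lambda>p. J p (X p))"

definition bilin :: "'a bilin_field \<Rightarrow> 'a vfield \<Rightarrow> 'a vfield \<Rightarrow> ('a \<Rightarrow> real)"
  where "bilin g X Y = (\<lambda>p. g p (X p) (Y p))"

definition smooth_endo_field ::
    "('a::topological_space, 'e::euclidean_space) chart set \<Rightarrow> 'a endo_field \<Rightarrow> bool"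
  where "smooth_endo_field A J \<longleftrightarrow>
    (\<forall>p. \<forall>v\<in>tangent_space A p.
       J p v \<in> tangent_space A p \<and>
       (\<forall>w\<in>tangent_space A p. J p (v + w) = J p v + J p w) \<and>
       (\<forall>c. J p (tscale c v) = tscale c (J p v))) \<and>
    (\<forall>X\<in>vector_fields A. endo J X \<in> vector_fields A)"

definition almost_complex ::
    "('a::topological_space, 'e::euclidean_space) chart set \<Rightarrow> 'a endo_field \<Rightarrow> bool"
  where "almost_complex A J \<longleftrightarrow> smooth_endo_field A J \<and>
    (\<forall>p. \<forall>v\<in>tangent_space A p. J p (J p v) = - v)"

text \<open>Linearity in the second argument follows from linearity in the first one by symmetry.\<close>

definition pseudo_riemannian ::
    "('a::topological_space, 'e::euclidean_space) chart set \<Rightarrow> 'a bilin_field \<Rightarrow> bool"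
  where "pseudo_riemannian A g \<longleftrightarrow>
    (\<forall>p. \<forall>v\<in>tangent_space A p.
       (\<forall>w\<in>tangent_space A p. g p v w = g p w v) \<and>
       (\<forall>v'\<in>tangent_space A p. \<forall>w\<in>tangent_space A p. g p (v + v') w = g p v w + g p v' w) \<and>
       (\<forall>c. \<forall>w\<in>tangent_space A p. g p (tscale c v) w = c * g p v w) \<and>
       ((\<forall>w\<in>tangent_space A p. g p v w = 0) \<longrightarrow> v = 0)) \<and>
    (\<forall>X\<in>vector_fields A. \<forall>Y\<in>vector_fields A. smooth_fun A (bilin g X Y))"

definition norden_manifold ::
    "nat \<Rightarrow> ('a::{t2_space,second_countable_topology}, 'e::euclidean_space) chart set \<Rightarrow>
     'a endo_field \<Rightarrow> 'a bilin_field \<Rightarrow> bool"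
  where "norden_manifold n A J g \<longleftrightarrow>
    smooth_atlas A \<and> DIM('e) = 2 * n \<and> almost_complex A J \<and> pseudo_riemannian A g \<and>
    (\<forall>p. \<forall>v\<in>tangent_space A p. \<forall>w\<in>tangent_space A p. g p (J p v) (J p w) = - g p v w)"

definition assoc_metric :: "'a endo_field \<Rightarrow> 'a bilin_field \<Rightarrow> 'a bilin_field"
  where "assoc_metric J g = (\<lambda>p v w. g p (J p v) w)"

type_synonym 'a connection = "'a vfield \<Rightarrow> 'a vfield \<Rightarrow> 'a vfield"

definition affine_connection ::
    "('a::topological_space, 'e::euclidean_space) chart set \<Rightarrow> 'a connection \<Rightarrow> bool"
  where "affine_connection A D \<longleftrightarrow>
    (\<forall>X\<in>vector_fields A. \<forall>Y\<in>vector_fields A.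
       D X Y \<in> vector_fields A \<and>
       (\<forall>Z\<in>vector_fields A. D (X + Z) Y = D X Y + D Z Y \<and> D X (Y + Z) = D X Y + D X Z) \<and>
       (\<forall>h. smooth_fun A h \<longrightarrow>
          D (vscale h X) Y = vscale h (D X Y) \<and>
          D X (vscale h Y) = vscale (vapply X h) Y + vscale h (D X Y)))"

definition levi_civita ::
    "('a::topological_space, 'e::euclidean_space) chart set \<Rightarrow> 'a bilin_field \<Rightarrow>
     'a connection \<Rightarrow> bool"
  where "levi_civita A g D \<longleftrightarrow> affine_connection A D \<and>
    (\<forall>X\<in>vector_fields A. \<forall>Y\<in>vector_fields A. D X Y - D Y X = lie_bracket A X Y) \<and>
    (\<forall>X\<in>vector_fields A. \<forall>Y\<in>vector_fields A. \<forall>Z\<in>vector_fields A.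
       vapply X (bilin g Y Z) = bilin g (D X Y) Z + bilin g Y (D X Z))"

section \<open>The Nijenhuis tensors\<close>

definition comm_bracket :: "'a connection \<Rightarrow> 'a vfield \<Rightarrow> 'a vfield \<Rightarrow> 'a vfield"
  where "comm_bracket D x y = D x y - D y x"

definition sym_bracket :: "'a connection \<Rightarrow> 'a vfield \<Rightarrow> 'a vfield \<Rightarrow> 'a vfield"
  where "sym_bracket D x y = D x y + D y x"

definition nijenhuis ::
    "'a endo_field \<Rightarrow> 'a connection \<Rightarrow> 'a vfield \<Rightarrow> 'a vfield \<Rightarrow> 'a vfield"
  where "nijenhuis J D x y =
    comm_bracket D (endo J x) (endo J y) - comm_bracket D x y
    - endo J (comm_bracket D (endo J x) y) - endo J (comm_bracket D x (endo J y))"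

definition assoc_nijenhuis ::
    "'a endo_field \<Rightarrow> 'a connection \<Rightarrow> 'a vfield \<Rightarrow> 'a vfield \<Rightarrow> 'a vfield"
  where "assoc_nijenhuis J D x y =
    sym_bracket D (endo J x) (endo J y) - sym_bracket D x y
    - endo J (sym_bracket D (endo J x) y) - endo J (sym_bracket D x (endo J y))"

end

theory Submission
  imports Defs "HOL-Computational_Algebra.Polynomial"
begin

text \<open>The Nijenhuis tensor is built from \<open>[x, y] = D\<^sub>x y - D\<^sub>y x\<close>, which for a torsion-free
  connection is the Lie bracket and so does not see the metric.

  For the associated Nijenhuis tensor, \<open>g(J y, z)\<close> is differentiated along \<open>x\<close> in two ways, once
  with \<open>D g = 0\<close> and once, reading it as the associated metric of \<open>y\<close> and \<open>z\<close>, with \<open>D'\<close>. The two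
  results agree. Written in terms of \<open>\<Phi> = D' - D\<close>, which is symmetric because both connections
  are torsion-free, this expresses
  \<open>F(x, y, z) = g((D\<^sub>x J) y, z)\<close> through \<open>T(x, y, z) = g(J \<Phi>(x, y), z)\<close> as
  \<open>F(x, y, z) = T(x, y, z) + T(x, z, y)\<close>. Koszul's trick inverts this relation:
  \<open>2 T(x, y, z) = F(x, y, z) + F(y, x, z) - F(z, x, y)\<close>. Both the tensor \<open>{J,J}\<close> of \<open>D\<close> and
  the difference of the two tensors \<open>{J,J}\<close> are thereby linear in \<open>F\<close>. With
  \<open>F(x, J y, z) = - F(x, y, J z)\<close>, the difference turns out to be \<open>- 2\<close> times the first, so the sum
  of the two tensors is \<open>g\<close>-orthogonal to every vector field
  (\<open>twin_assoc_nijenhuis_sum_orthogonal\<close>).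

  Nondegeneracy of \<open>g\<close> is a statement about tangent vectors at a point, whereas the argument above
  takes derivatives and so needs vector fields. The analytic part of the proof closes this gap:
  every tangent vector is the value of a smooth vector field (\<open>tangent_vector_extends\<close>), namely of
  a constant coordinate field multiplied by a bump function.\<close>

section \<open>Calculus of smooth functions\<close>

lemma C_on_cong:
  assumes "open S" "\<And>x. x \<in> S \<Longrightarrow> f x = g x" "C_on k S f"
  shows "C_on k S g"
  using assms(2,3)
proof (induction k arbitrary: f g)
  case 0
  then show ?case by (metis C_on.simps(1) continuous_on_cong)
next
  case (Suc k)
  have D: "(g has_derivative frechet_derivative f (at x)) (at x)" if "x \<in> S" for x
    using has_derivative_transform_within_open[OF _ assms(1) that] Suc.prems that
    by (metis C_on.simps(2) frechet_derivative_works)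
  then have "frechet_derivative f (at x) = frechet_derivative g (at x)" if "x \<in> S" for x
    using frechet_derivative_at that by blast
  then have "C_on k S (\<lambda>x. frechet_derivative g (at x) v)" for v
    using Suc.IH[of "\<lambda>x. frechet_derivative f (at x) v"] Suc.prems(2) by simp
  with D show ?case by (auto simp: differentiable_def)
qed

lemma C_on_SucI:
  assumes "open S" "\<And>x. x \<in> S \<Longrightarrow> (f has_derivative f' x) (at x)"
    and "\<And>v. C_on k S (\<lambda>x. f' x v)"
  shows "C_on (Suc k) S f"
proof -
  have "f' x = frechet_derivative f (at x)" if "x \<in> S" for x
    using frechet_derivative_at assms(2) that by blast
  then have "C_on k S (\<lambda>x. frechet_derivative f (at x) v)" for v
    by (intro C_on_cong[OF assms(1) _ assms(3)]) simp
  with assms(2) show ?thesis by (auto simp: differentiable_def)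
qed

lemma C_on_Suc_has_derivative:
  "C_on (Suc k) S f \<Longrightarrow> x \<in> S \<Longrightarrow> (f has_derivative frechet_derivative f (at x)) (at x)"
  by (simp add: frechet_derivative_works)

lemma C_on_Suc_imp_C_on: "C_on (Suc k) S f \<Longrightarrow> C_on k S f"
proof (induction k arbitrary: f)
  case 0
  then show ?case
    by (auto intro!: continuous_at_imp_continuous_on differentiable_imp_continuous_within)
next
  case (Suc k)
  show ?case
    unfolding C_on.simps(2)[of k]
  proof (intro conjI allI)
    show "\<forall>x\<in>S. f differentiable at x" using Suc.prems unfolding C_on.simps(2) by blast
    show "C_on k S (\<lambda>x. frechet_derivative f (at x) v)" for v
      by (rule Suc.IH) (use Suc.prems in \<open>unfold C_on.simps(2)[of "Suc k"], blast\<close>)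
  qed
qed

lemma C_on_subset: "C_on k S f \<Longrightarrow> T \<subseteq> S \<Longrightarrow> C_on k T f"
proof (induction k arbitrary: f)
  case 0
  then show ?case by (simp add: continuous_on_subset)
next
  case (Suc k)
  then show ?case by (simp add: subset_iff)
qed

lemma C_on_Un:
  "\<lbrakk>open S; open T; C_on k S f; C_on k T f\<rbrakk> \<Longrightarrow> C_on k (S \<union> T) f"
proof (induction k arbitrary: f)
  case 0
  then show ?case by (simp add: continuous_on_open_Un)
next
  case (Suc k)
  then show ?case by (simp add: ball_Un)
qed

lemma C_on_const: "open S \<Longrightarrow> C_on k S (\<lambda>x. c)"
proof (induction k arbitrary: c)
  case (Suc k)
  show ?case
    by (rule C_on_SucI[where f' = "\<lambda>_ _. 0"]) (use Suc in auto)
qed simp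

lemma C_on_bounded_linear:
  assumes "open S" "bounded_linear L"
  shows "C_on k S f \<Longrightarrow> C_on k S (\<lambda>x. L (f x))"
proof (induction k arbitrary: f)
  case 0
  then show ?case using assms(2) by (simp add: bounded_linear.continuous_on)
next
  case (Suc k)
  show ?case
  proof (rule C_on_SucI[OF assms(1)])
    show "((\<lambda>x. L (f x)) has_derivative (\<lambda>v. L (frechet_derivative f (at x) v))) (at x)"
      if "x \<in> S" for x
      by (rule bounded_linear.has_derivative[OF assms(2) C_on_Suc_has_derivative[OF Suc.prems that]])
  qed (use Suc in simp)
qed

lemma C_on_add:
  assumes "open S"
  shows "C_on k S f \<Longrightarrow> C_on k S g \<Longrightarrow> C_on k S (\<lambda>x. f x + g x)"
proof (induction k arbitrary: f g)
  case 0
  then show ?case by (simp add: continuous_on_add)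
next
  case (Suc k)
  show ?case
  proof (rule C_on_SucI[OF assms])
    show "((\<lambda>x. f x + g x) has_derivative
        (\<lambda>v. frechet_derivative f (at x) v + frechet_derivative g (at x) v)) (at x)"
      if "x \<in> S" for x
      by (rule has_derivative_add[OF Suc.prems(1)[THEN C_on_Suc_has_derivative, OF that]
            Suc.prems(2)[THEN C_on_Suc_has_derivative, OF that]])
  qed (use Suc in simp)
qed

lemma C_on_sum:
  assumes "open S" "\<And>i. i \<in> I \<Longrightarrow> C_on k S (f i)"
  shows "C_on k S (\<lambda>x. \<Sum>i\<in>I. f i x)"
  using assms(2)
proof (induction I rule: infinite_finite_induct)
  case (insert i I)
  then have "C_on k S (\<lambda>x. f i x + (\<Sum>i\<in>I. f i x))" by (intro C_on_add[OF assms(1)]) simp_all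
  with insert.hyps show ?case by simp
qed (simp_all add: C_on_const[OF assms(1)])

lemma C_on_mult:
  fixes f g :: "'a::real_normed_vector \<Rightarrow> real"
  assumes "open S"
  shows "C_on k S f \<Longrightarrow> C_on k S g \<Longrightarrow> C_on k S (\<lambda>x. f x * g x)"
proof (induction k arbitrary: f g)
  case 0
  then show ?case by (simp add: continuous_on_mult)
next
  case (Suc k)
  show ?case
  proof (rule C_on_SucI[OF assms])
    show "((\<lambda>x. f x * g x) has_derivative
        (\<lambda>v. f x * frechet_derivative g (at x) v + frechet_derivative f (at x) v * g x)) (at x)"
      if "x \<in> S" for x
      by (rule has_derivative_mult[OF Suc.prems(1)[THEN C_on_Suc_has_derivative, OF that]
            Suc.prems(2)[THEN C_on_Suc_has_derivative, OF that]])
    show "C_on k S (\<lambda>x. f x * frechet_derivative g (at x) v + frechet_derivative f (at x) v * g x)"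
      for v
    proof (rule C_on_add[OF assms])
      show "C_on k S (\<lambda>x. f x * frechet_derivative g (at x) v)"
        by (rule Suc.IH[OF C_on_Suc_imp_C_on[OF Suc.prems(1)]]) (use Suc.prems(2) in simp)
      show "C_on k S (\<lambda>x. frechet_derivative f (at x) v * g x)"
        by (rule Suc.IH[OF _ C_on_Suc_imp_C_on[OF Suc.prems(2)]]) (use Suc.prems(1) in simp)
    qed
  qed
qed

text \<open>The chain rule gives \<open>D (h \<circ> t)(x) v = \<Sum>i. (D t(x) v)\<^sub>i (\<partial>\<^sub>i h)(t x)\<close>. The sum over a basis is
  what makes the induction work, since \<^const>\<open>C_on\<close> controls the derivative of \<open>h\<close> only in fixed
  directions, while \<open>D t(x) v\<close> varies with \<open>x\<close>.\<close>

lemma C_on_compose: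
  fixes t :: "'a::real_normed_vector \<Rightarrow> 'b::euclidean_space" and h :: "'b \<Rightarrow> real"
  assumes "open S" "t ` S \<subseteq> T"
  shows "C_on k T h \<Longrightarrow> C_on k S t \<Longrightarrow> C_on k S (\<lambda>x. h (t x))"
proof (induction k arbitrary: h)
  case 0
  then show ?case using continuous_on_compose2[of T h S t] assms(2) by simp
next
  case (Suc k)
  let ?dt = "\<lambda>x. frechet_derivative t (at x)" and ?dh = "\<lambda>y. frechet_derivative h (at y)"
  show ?case
  proof (rule C_on_SucI[OF assms(1)])
    show "((\<lambda>x. h (t x)) has_derivative
        (\<lambda>v. \<Sum>i\<in>Basis. (?dt x v \<bullet> i) * ?dh (t x) i)) (at x)" if x: "x \<in> S" for x
    proof -
      have h: "(h has_derivative ?dh (t x)) (at (t x))"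
        using C_on_Suc_has_derivative[OF Suc.prems(1)] assms(2) x by auto
      have "?dh (t x) w = (\<Sum>i\<in>Basis. (w \<bullet> i) * ?dh (t x) i)" for w
      proof -
        have l: "linear (?dh (t x))" using h has_derivative_linear by blast
        have "?dh (t x) w = ?dh (t x) (\<Sum>i\<in>Basis. (w \<bullet> i) *\<^sub>R i)"
          by (simp add: euclidean_representation)
        also have "\<dots> = (\<Sum>i\<in>Basis. (w \<bullet> i) * ?dh (t x) i)"
          by (simp add: linear_sum[OF l] linear_cmul[OF l])
        finally show ?thesis .
      qed
      then have "(\<lambda>v. ?dh (t x) (?dt x v)) = (\<lambda>v. \<Sum>i\<in>Basis. (?dt x v \<bullet> i) * ?dh (t x) i)"
        by (intro ext)
      with has_derivative_compose[OF C_on_Suc_has_derivative[OF Suc.prems(2) x] h]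
      show ?thesis by (rule back_subst[where P = "\<lambda>d. (_ has_derivative d) _"])
    qed
    show "C_on k S (\<lambda>x. \<Sum>i\<in>Basis. (?dt x v \<bullet> i) * ?dh (t x) i)" for v
    proof (intro C_on_sum C_on_mult assms(1))
      fix i :: 'b
      show "C_on k S (\<lambda>x. ?dt x v \<bullet> i)"
        by (rule C_on_bounded_linear[OF assms(1) bounded_linear_inner_left])
          (use Suc.prems(2) in simp)
      show "C_on k S (\<lambda>x. ?dh (t x) i)"
        by (rule Suc.IH[OF _ C_on_Suc_imp_C_on[OF Suc.prems(2)]]) (use Suc.prems(1) in simp)
    qed
  qed
qed

lemma smooth_onD: "smooth_on S f \<Longrightarrow> C_on k S f"
  by (simp add: smooth_on_def)

lemma smooth_on_frechet_derivative:
  "smooth_on S f \<Longrightarrow> smooth_on S (\<lambda>x. frechet_derivative f (at x) v)"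
  unfolding smooth_on_def
proof
  fix k assume "\<forall>k. C_on k S f"
  then have "C_on (Suc k) S f" ..
  then show "C_on k S (\<lambda>x. frechet_derivative f (at x) v)" by simp
qed

lemma smooth_on_has_derivative:
  "smooth_on S f \<Longrightarrow> x \<in> S \<Longrightarrow> (f has_derivative frechet_derivative f (at x)) (at x)"
  using C_on_Suc_has_derivative smooth_onD by blast

section \<open>Bump functions\<close>

text \<open>The polynomial factor makes the family closed under differentiation, so that smoothness of
  \<open>exp (- 1 / t)\<close>, extended by \<open>0\<close>, follows by induction for all members at once.\<close>

definition flat :: "real poly \<Rightarrow> real \<Rightarrow> real"
  where "flat P t = (if t > 0 then poly P (1 / t) * exp (- 1 / t) else 0)"

text \<open>In \<open>s = 1 / t\<close> this is the decay of \<open>P(s) exp (- s)\<close> at infinity.\<close>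

lemma flat_tendsto_0: "(flat P \<longlongrightarrow> 0) (at 0)"
proof -
  have "((\<lambda>x. poly P x * exp (- x)) \<longlongrightarrow> 0) at_top"
  proof -
    have "((\<lambda>x. \<Sum>i\<le>degree P. coeff P i * (x ^ i / exp x)) \<longlongrightarrow> (\<Sum>i\<le>degree P. coeff P i * 0)) at_top"
      by (intro tendsto_intros tendsto_power_div_exp_0)
    then show ?thesis
      by (simp add: poly_altdef sum_distrib_right exp_minus divide_inverse mult.assoc)
  qed
  then have "((\<lambda>t. poly P (inverse t) * exp (- inverse t)) \<longlongrightarrow> 0) (at_right 0)"
    by (rule filterlim_compose) (rule filterlim_inverse_at_top_right)
  then have "(flat P \<longlongrightarrow> 0) (at_right 0)"
    by (rule Lim_transform_eventually)
       (auto simp: flat_def eventually_at_filter inverse_eq_divide)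
  moreover have "(flat P \<longlongrightarrow> 0) (at_left 0)"
    by (rule Lim_transform_eventually[OF tendsto_const])
       (auto simp: flat_def eventually_at_filter)
  ultimately show ?thesis by (simp add: filterlim_split_at)
qed

text \<open>Away from \<open>0\<close> this is the product rule, as the derivative of \<open>1 / t\<close> is \<open>- 1 / t\<^sup>2\<close>. At \<open>0\<close>, the
  difference quotient of \<^term>\<open>flat P\<close> is again a function of the family, with \<open>P\<close> multiplied by the
  variable, and so tends to \<open>0\<close>.\<close>

lemma flat_has_derivative:
  "(flat P has_real_derivative flat ([:0, 0, 1:] * (P - pderiv P)) t) (at t)"
proof -
  consider "t > 0" | "t < 0" | "t = 0" by linarith
  then show ?thesis
  proof cases
    case 1
    have "((\<lambda>t. poly P (1 / t) * exp (- 1 / t)) has_real_derivative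
        flat ([:0, 0, 1:] * (P - pderiv P)) t) (at t)"
      using 1 by (auto intro!: derivative_eq_intros DERIV_chain2[OF poly_DERIV]
          simp: flat_def field_simps power2_eq_square)
    then show ?thesis
      by (rule has_field_derivative_transform_within_open[of _ _ _ "{0<..}"])
         (use 1 in \<open>auto simp: flat_def\<close>)
  next
    case 2
    have "((\<lambda>t. 0) has_real_derivative flat ([:0, 0, 1:] * (P - pderiv P)) t) (at t)"
      using 2 by (simp add: flat_def)
    then show ?thesis
      by (rule has_field_derivative_transform_within_open[of _ _ _ "{..<0}"])
         (use 2 in \<open>auto simp: flat_def\<close>)
  next
    case 3
    have "(\<lambda>t. (flat P t - flat P 0) / (t - 0)) = flat ([:0, 1:] * P)"
      by (auto simp: flat_def)
    then show ?thesis
      using flat_tendsto_0[of "[:0, 1:] * P"] 3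
      by (simp add: has_field_derivative_iff flat_def[of _ 0])
  qed
qed

lemma C_on_flat: "C_on k UNIV (flat P)"
proof (induction k arbitrary: P)
  case 0
  show ?case
    using flat_has_derivative[THEN DERIV_isCont] by (simp add: continuous_at_imp_continuous_on)
next
  case (Suc k)
  show ?case
  proof (rule C_on_SucI)
    show "(flat P has_derivative (*) (flat ([:0, 0, 1:] * (P - pderiv P)) t)) (at t)" for t
      using flat_has_derivative by (simp add: has_field_derivative_def)
    show "C_on k UNIV (\<lambda>t. flat ([:0, 0, 1:] * (P - pderiv P)) t * v)" for v
      by (intro C_on_mult C_on_const Suc.IH open_UNIV)
  qed simp
qed

text \<open>The function is \<open>flat 1 (r\<^sup>2 - |x - a|\<^sup>2)\<close>, normalised at \<open>a\<close>.\<close>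

lemma bump_function:
  fixes a :: "'e::euclidean_space"
  assumes "r > 0"
  obtains b :: "'e \<Rightarrow> real" where "smooth_on UNIV b" "b a = 1" "\<And>x. x \<notin> cball a r \<Longrightarrow> b x = 0"
proof
  \<comment> \<open>The squared norm is written in coordinates to show smoothness from sums and products.\<close>
  define q where "q = (\<lambda>x. r\<^sup>2 + (\<Sum>i\<in>Basis. (- ((x - a) \<bullet> i)) * ((x - a) \<bullet> i)))"
  let ?b = "\<lambda>x. flat 1 (q x) * inverse (flat 1 (r\<^sup>2))"
  have q: "q x = r\<^sup>2 - (norm (x - a))\<^sup>2" for x
    by (simp add: q_def power2_norm_eq_inner euclidean_inner[of "x - a" "x - a"] sum_negf)
  have lin: "C_on k UNIV (\<lambda>x::'e. x)" for k
  proof (cases k)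
    case (Suc m)
    show ?thesis
      unfolding Suc by (rule C_on_SucI[where f' = "\<lambda>_ v. v"]) (auto intro: C_on_const)
  qed simp
  have coord: "C_on k UNIV (\<lambda>x. (x - a) \<bullet> i)" for k i
  proof -
    have "C_on k UNIV (\<lambda>x. x \<bullet> i + - (a \<bullet> i))"
      by (intro C_on_add C_on_const open_UNIV C_on_bounded_linear[OF _ bounded_linear_inner_left] lin)
    then show ?thesis by (simp add: inner_diff_left)
  qed
  have "C_on k UNIV (\<lambda>x. - ((x - a) \<bullet> i))" for k i
    by (rule C_on_bounded_linear[OF open_UNIV bounded_linear_minus[OF bounded_linear_ident] coord])
  then have "C_on k UNIV q" for k
    unfolding q_def by (intro C_on_add C_on_const C_on_sum C_on_mult open_UNIV coord)
  then have "C_on k UNIV (\<lambda>x. flat 1 (q x))" for k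
    by (rule C_on_compose[OF open_UNIV subset_UNIV C_on_flat])
  then show "smooth_on UNIV ?b"
    unfolding smooth_on_def by (intro allI C_on_mult C_on_const open_UNIV)
  show "?b a = 1" using assms by (simp add: q flat_def)
  show "?b x = 0" if "x \<notin> cball a r" for x
  proof -
    have "r < norm (x - a)" using that by (simp add: dist_norm norm_minus_commute)
    then have "r\<^sup>2 < (norm (x - a))\<^sup>2" using assms by (intro power_strict_mono) auto
    then show ?thesis by (simp add: q flat_def)
  qed
qed

section \<open>Tangent spaces and extension of tangent vectors\<close>

lemma smooth_atlas_open:
  assumes "smooth_atlas A" "(U, \<phi>) \<in> A"
  shows "open U" and "open W \<Longrightarrow> open (\<phi> ` (U \<inter> W))" and "inj_on \<phi> U"
    and "continuous_on (\<phi> ` U) (inv_into U \<phi>)"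
proof -
  have U: "open U" "open (\<phi> ` U)" and h: "homeomorphism U (\<phi> ` U) \<phi> (inv_into U \<phi>)"
    using bspec[OF conjunct1[OF assms(1)[unfolded smooth_atlas_def]] assms(2)]
    by (simp_all add: is_chart_def)
  then show "open U" "continuous_on (\<phi> ` U) (inv_into U \<phi>)" by (simp_all add: homeomorphism_def)
  show "inj_on \<phi> U" using h by (metis homeomorphism_def inj_on_inverseI)
  show "open (\<phi> ` (U \<inter> W))" if "open W"
  proof -
    have "openin (top_of_set U) (U \<inter> W)" using that by (simp add: openin_open_Int)
    then have "openin (top_of_set (\<phi> ` U)) (\<phi> ` (U \<inter> W))"
      by (rule homeomorphism_imp_open_map[OF h])
    then show ?thesis using U(2) openin_open_trans by blast
  qed
qed

lemma smooth_atlas_transition: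
  assumes "smooth_atlas A" "(U, \<phi>) \<in> A" "(V, \<psi>) \<in> A"
  shows "smooth_on (\<phi> ` (U \<inter> V)) (\<psi> \<circ> inv_into U \<phi>)"
proof -
  have "\<forall>c\<in>A. \<forall>d\<in>A. smooth_on (snd c ` (fst c \<inter> fst d)) (snd d \<circ> inv_into (fst c) (snd c))"
    using assms(1) unfolding smooth_atlas_def case_prod_beta by (elim conjE)
  from bspec[OF bspec[OF this assms(2)] assms(3)] show ?thesis by simp
qed

lemma smooth_atlas_chart_at:
  assumes "smooth_atlas A"
  obtains U \<phi> where "(U, \<phi>) \<in> A" "p \<in> U"
proof -
  have "p \<in> (\<Union>c\<in>A. fst c)" using assms by (simp add: smooth_atlas_def)
  then show ?thesis using that by auto
qed

lemma coord_vector_has_derivative: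
  assumes "(U, \<phi>) \<in> A" "p \<in> U" "smooth_fun A f"
  shows "((f \<circ> inv_into U \<phi>) has_derivative (\<lambda>e. coord_vector A (U, \<phi>) p e f)) (at (\<phi> p))"
proof -
  have "smooth_on (\<phi> ` U) (f \<circ> inv_into U \<phi>)" using assms by (auto simp: smooth_fun_def)
  then show ?thesis
    using smooth_on_has_derivative[OF _ imageI[OF assms(2)]] assms(3)
    unfolding coord_vector_def by (simp only: split if_True)
qed

lemma coord_vector_linear:
  assumes "(U, \<phi>) \<in> A" "p \<in> U"
  shows "coord_vector A (U, \<phi>) p (e + e') = coord_vector A (U, \<phi>) p e + coord_vector A (U, \<phi>) p e'"
    and "coord_vector A (U, \<phi>) p (c *\<^sub>R e) = tscale c (coord_vector A (U, \<phi>) p e)"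
proof -
  have "coord_vector A (U, \<phi>) p (e + e') f
        = coord_vector A (U, \<phi>) p e f + coord_vector A (U, \<phi>) p e' f \<and>
      coord_vector A (U, \<phi>) p (c *\<^sub>R e) f = c * coord_vector A (U, \<phi>) p e f" for f
  proof (cases "smooth_fun A f")
    case True
    then have "linear (\<lambda>e. coord_vector A (U, \<phi>) p e f)"
      using coord_vector_has_derivative[OF assms] has_derivative_linear by blast
    from linear_add[OF this] linear_cmul[OF this] show ?thesis by simp
  qed (simp add: coord_vector_def)
  then show "coord_vector A (U, \<phi>) p (e + e') = coord_vector A (U, \<phi>) p e + coord_vector A (U, \<phi>) p e'"
    and "coord_vector A (U, \<phi>) p (c *\<^sub>R e) = tscale c (coord_vector A (U, \<phi>) p e)"
    by (simp_all add: fun_eq_iff tscale_def)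
qed

text \<open>The chain rule for \<open>f \<circ> \<phi>\<inverse> = (f \<circ> \<psi>\<inverse>) \<circ> (\<psi> \<circ> \<phi>\<inverse>)\<close>, an identity that holds on
  \<open>\<phi> ` (U \<inter> V)\<close> only.\<close>

lemma coord_vector_change_chart:
  assumes A: "smooth_atlas A" "(U, \<phi>) \<in> A" "(V, \<psi>) \<in> A" and p: "p \<in> U" "p \<in> V"
  shows "coord_vector A (U, \<phi>) p e =
    coord_vector A (V, \<psi>) p (frechet_derivative (\<psi> \<circ> inv_into U \<phi>) (at (\<phi> p)) e)"
proof
  fix f
  note inj = smooth_atlas_open(3)[OF A(1,2)]
  let ?t = "\<psi> \<circ> inv_into U \<phi>"
  show "coord_vector A (U, \<phi>) p e f = coord_vector A (V, \<psi>) p (frechet_derivative ?t (at (\<phi> p)) e) f"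
  proof (cases "smooth_fun A f")
    case True
    have "(?t has_derivative frechet_derivative ?t (at (\<phi> p))) (at (\<phi> p))"
      using smooth_atlas_transition[OF A] p by (auto intro!: smooth_on_has_derivative)
    moreover have "?t (\<phi> p) = \<psi> p" using inj p by simp
    moreover note coord_vector_has_derivative[OF A(3) p(2) True]
    ultimately have "((\<lambda>x. (f \<circ> inv_into V \<psi>) (?t x)) has_derivative
        (\<lambda>e. coord_vector A (V, \<psi>) p (frechet_derivative ?t (at (\<phi> p)) e) f)) (at (\<phi> p))"
      using has_derivative_compose[of ?t _ "\<phi> p" UNIV "f \<circ> inv_into V \<psi>"] by simp
    then have "((f \<circ> inv_into U \<phi>) has_derivative
        (\<lambda>e. coord_vector A (V, \<psi>) p (frechet_derivative ?t (at (\<phi> p)) e) f)) (at (\<phi> p))"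
    proof (rule has_derivative_transform_within_open)
      show "open (\<phi> ` (U \<inter> V))"
        using smooth_atlas_open(2)[OF A(1,2)] smooth_atlas_open(1)[OF A(1,3)] by blast
      show "\<phi> p \<in> \<phi> ` (U \<inter> V)" using p by blast
      show "(f \<circ> inv_into V \<psi>) (?t x) = (f \<circ> inv_into U \<phi>) x" if "x \<in> \<phi> ` (U \<inter> V)" for x
        using that inj smooth_atlas_open(3)[OF A(1,3)] by auto
    qed
    from has_derivative_unique[OF this coord_vector_has_derivative[OF A(2) p(1) True]]
    show ?thesis by (rule fun_cong[THEN sym])
  qed (simp add: coord_vector_def)
qed

text \<open>A single chart at \<open>p\<close> already yields all tangent vectors. This is what makes the tangent space
  a vector space, since two vectors may be given in different charts.\<close>

lemma tangent_space_eq_range: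
  assumes "smooth_atlas A" "(U, \<phi>) \<in> A" "p \<in> U"
  shows "tangent_space A p = range (coord_vector A (U, \<phi>) p)"
proof
  show "tangent_space A p \<subseteq> range (coord_vector A (U, \<phi>) p)"
  proof
    fix v assume "v \<in> tangent_space A p"
    then obtain V \<psi> e where "v = coord_vector A (V, \<psi>) p e" "(V, \<psi>) \<in> A" "p \<in> V"
      unfolding tangent_space_def by auto
    with coord_vector_change_chart[OF assms(1) _ assms(2) _ assms(3)]
    show "v \<in> range (coord_vector A (U, \<phi>) p)" by blast
  qed
  show "range (coord_vector A (U, \<phi>) p) \<subseteq> tangent_space A p"
  proof
    fix v assume "v \<in> range (coord_vector A (U, \<phi>) p)"
    then obtain e where "v = coord_vector A (U, \<phi>) p e" by blast
    moreover have "p \<in> fst (U, \<phi>)" using assms(3) by simp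
    ultimately show "v \<in> tangent_space A p" unfolding tangent_space_def using assms(2) by blast
  qed
qed

lemma tangent_space_add:
  assumes "smooth_atlas A" "v \<in> tangent_space A p" "w \<in> tangent_space A p"
  shows "v + w \<in> tangent_space A p"
proof -
  obtain U \<phi> where c: "(U, \<phi>) \<in> A" "p \<in> U" using smooth_atlas_chart_at[OF assms(1)] .
  show ?thesis
    using assms(2,3) unfolding tangent_space_eq_range[OF assms(1) c]
    by (auto simp: coord_vector_linear(1)[OF c, symmetric])
qed

lemma tangent_space_tscale:
  assumes "smooth_atlas A" "v \<in> tangent_space A p"
  shows "tscale a v \<in> tangent_space A p"
proof -
  obtain U \<phi> where c: "(U, \<phi>) \<in> A" "p \<in> U" using smooth_atlas_chart_at[OF assms(1)] .
  show ?thesis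
    using assms(2) unfolding tangent_space_eq_range[OF assms(1) c]
    by (auto simp: coord_vector_linear(2)[OF c, symmetric])
qed

lemma vector_fields_tangent: "X \<in> vector_fields A \<Longrightarrow> X p \<in> tangent_space A p"
  by (simp add: vector_fields_def)

lemma uminus_tvec_eq_tscale: "- v = tscale (- 1) v"
  by (simp add: tscale_def fun_eq_iff)

lemma vector_fields_add:
  assumes A: "smooth_atlas A" and X: "X \<in> vector_fields A" and Y: "Y \<in> vector_fields A"
  shows "X + Y \<in> vector_fields A"
proof -
  have "smooth_fun A (vapply (X + Y) f)" if "smooth_fun A f" for f
    unfolding smooth_fun_def
  proof safe
    fix U \<phi> assume c: "(U, \<phi>) \<in> A"
    have "smooth_on (\<phi> ` U) (vapply X f \<circ> inv_into U \<phi>)" "smooth_on (\<phi> ` U) (vapply Y f \<circ> inv_into U \<phi>)"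
      using X Y that c by (auto simp: vector_fields_def smooth_fun_def)
    moreover have "open (\<phi> ` U)" using smooth_atlas_open(2)[OF A c open_UNIV] by simp
    moreover have "vapply (X + Y) f \<circ> inv_into U \<phi> =
        (\<lambda>x. (vapply X f \<circ> inv_into U \<phi>) x + (vapply Y f \<circ> inv_into U \<phi>) x)"
      by (auto simp: vapply_def)
    ultimately show "smooth_on (\<phi> ` U) (vapply (X + Y) f \<circ> inv_into U \<phi>)"
      by (simp only: smooth_on_def C_on_add simp_thms)
  qed
  then show ?thesis
    using X Y tangent_space_add[OF A] by (simp add: vector_fields_def)
qed

lemma vector_fields_uminus:
  assumes A: "smooth_atlas A" and X: "X \<in> vector_fields A"
  shows "- X \<in> vector_fields A"
proof -
  have "smooth_fun A (vapply (- X) f)" if "smooth_fun A f" for f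
    unfolding smooth_fun_def
  proof safe
    fix U \<phi> assume c: "(U, \<phi>) \<in> A"
    have "smooth_on (\<phi> ` U) (vapply X f \<circ> inv_into U \<phi>)"
      using X that c by (auto simp: vector_fields_def smooth_fun_def)
    moreover have "open (\<phi> ` U)" using smooth_atlas_open(2)[OF A c open_UNIV] by simp
    moreover have "vapply (- X) f \<circ> inv_into U \<phi> = (\<lambda>x. - (vapply X f \<circ> inv_into U \<phi>) x)"
      by (auto simp: vapply_def)
    ultimately show "smooth_on (\<phi> ` U) (vapply (- X) f \<circ> inv_into U \<phi>)"
      by (simp only: smooth_on_def simp_thms
          C_on_bounded_linear[OF _ bounded_linear_minus[OF bounded_linear_ident]])
  qed
  then show ?thesis
    using X tangent_space_tscale[OF A] by (simp add: vector_fields_def uminus_tvec_eq_tscale)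
qed

lemma vector_fields_diff:
  "smooth_atlas A \<Longrightarrow> X \<in> vector_fields A \<Longrightarrow> Y \<in> vector_fields A \<Longrightarrow> X - Y \<in> vector_fields A"
  using vector_fields_add[OF _ _ vector_fields_uminus, of A X Y] by simp

text \<open>With \<open>w\<close> having the components \<open>e\<close> in a chart \<open>(U, \<phi>)\<close>, the field \<open>\<Sum>i. e\<^sub>i \<partial>/\<partial>x\<^sub>i\<close> is defined on
  \<open>U\<close> only. It is multiplied by a bump function in the coordinates and extended by \<open>0\<close>. The bump
  vanishes off a compact set \<open>K \<subseteq> U\<close>, which is closed since the manifold is Hausdorff. So the manifold
  is covered by two open sets: \<open>U\<close>, where smoothness follows by passing to \<open>\<phi>\<close>-coordinates, and
  \<open>- K\<close>, where the field vanishes.\<close>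

lemma tangent_vector_extends:
  fixes A :: "('a::{t2_space,second_countable_topology}, 'e::euclidean_space) chart set"
  assumes A: "smooth_atlas A" and w: "w \<in> tangent_space A p"
  obtains Z where "Z \<in> vector_fields A" "Z p = w"
proof -
  obtain U \<phi> where c: "(U, \<phi>) \<in> A" and p: "p \<in> U" using smooth_atlas_chart_at[OF A] .
  obtain e where e: "w = coord_vector A (U, \<phi>) p e"
    using w tangent_space_eq_range[OF A c p] by blast
  have "open (\<phi> ` U)" using smooth_atlas_open(2)[OF A c open_UNIV] by simp
  then obtain r where r: "r > 0" "cball (\<phi> p) r \<subseteq> \<phi> ` U"
    using p open_contains_cball by blast
  obtain b :: "'e \<Rightarrow> real" where b: "smooth_on UNIV b" "b (\<phi> p) = 1"
      "\<And>x. x \<notin> cball (\<phi> p) r \<Longrightarrow> b x = 0"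
    using bump_function[OF r(1), where a = "\<phi> p"] by blast
  define K where "K = inv_into U \<phi> ` cball (\<phi> p) r"
  have "continuous_on (cball (\<phi> p) r) (inv_into U \<phi>)"
    using smooth_atlas_open(4)[OF A c] r(2) continuous_on_subset by blast
  then have "closed K"
    unfolding K_def by (intro compact_imp_closed compact_continuous_image compact_cball)
  define Z where
    "Z = (\<lambda>q. if q \<in> U then tscale (b (\<phi> q)) (coord_vector A (U, \<phi>) q e) else 0)"
  have Z_tangent: "Z q \<in> tangent_space A q" for q
  proof (cases "q \<in> U")
    case True
    then have "coord_vector A (U, \<phi>) q e \<in> tangent_space A q"
      using tangent_space_eq_range[OF A c] by blast
    then show ?thesis using True tangent_space_tscale[OF A] by (simp add: Z_def)
  next
    case False
    obtain V \<psi> where "(V, \<psi>) \<in> A" "q \<in> V" using smooth_atlas_chart_at[OF A] .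
    then have "tscale 0 (coord_vector A (V, \<psi>) q 0) \<in> tangent_space A q"
      using tangent_space_eq_range[OF A] tangent_space_tscale[OF A] by blast
    then show ?thesis using False by (simp add: Z_def tscale_def func_zero)
  qed
  have "smooth_fun A (vapply Z f)" if f: "smooth_fun A f" for f
    unfolding smooth_fun_def
  proof safe
    fix V \<psi> assume d: "(V, \<psi>) \<in> A"
    note injV = smooth_atlas_open(3)[OF A d] and injU = smooth_atlas_open(3)[OF A c]
    let ?Zf = "vapply Z f \<circ> inv_into V \<psi>"
    let ?h = "\<lambda>x. b x * frechet_derivative (f \<circ> inv_into U \<phi>) (at x) e"
    have o1: "open (\<psi> ` (V \<inter> U))" and o2: "open (\<psi> ` (V \<inter> - K))"
      using smooth_atlas_open(2)[OF A d] smooth_atlas_open(1)[OF A c] \<open>closed K\<close> by blast+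
    have "smooth_on (\<phi> ` U) (f \<circ> inv_into U \<phi>)" using f c by (auto simp: smooth_fun_def)
    then have h: "C_on k (\<phi> ` U) ?h" for k
      by (intro C_on_mult[OF \<open>open (\<phi> ` U)\<close>] C_on_subset[OF smooth_onD[OF b(1)] subset_UNIV]
          smooth_onD[OF smooth_on_frechet_derivative])
    have "C_on k (\<psi> ` (V \<inter> U)) (\<lambda>x. ?h ((\<phi> \<circ> inv_into V \<psi>) x))" for k
      by (rule C_on_compose[OF o1 _ h smooth_onD[OF smooth_atlas_transition[OF A d c]]])
        (use injV in auto)
    then have s1: "C_on k (\<psi> ` (V \<inter> U)) ?Zf" for k
      by (rule C_on_cong[OF o1, rotated])
        (use injV f in \<open>auto simp: Z_def vapply_def tscale_def coord_vector_def\<close>)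
    have "?Zf x = 0" if x: "x \<in> \<psi> ` (V \<inter> - K)" for x
    proof -
      obtain q where q: "q \<in> V" "q \<notin> K" "x = \<psi> q" using x by blast
      have "b (\<phi> q) = 0" if "q \<in> U"
      proof (rule b(3))
        show "\<phi> q \<notin> cball (\<phi> p) r"
          using q(2) imageI[of "\<phi> q" "cball (\<phi> p) r" "inv_into U \<phi>"] inv_into_f_f[OF injU that]
          unfolding K_def by auto
      qed
      then show ?thesis using q injV by (simp add: Z_def vapply_def tscale_def)
    qed
    then have s2: "C_on k (\<psi> ` (V \<inter> - K)) ?Zf" for k
      by (intro C_on_cong[OF o2 _ C_on_const[OF o2, of k 0]]) (rule sym)
    have "K \<subseteq> U" using r(2) unfolding K_def by (auto intro: inv_into_into)
    then have "\<psi> ` V = \<psi> ` (V \<inter> U) \<union> \<psi> ` (V \<inter> - K)" by blast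
    then show "smooth_on (\<psi> ` V) ?Zf"
      unfolding smooth_on_def using C_on_Un[OF o1 o2 s1 s2] by (simp only: simp_thms)
  qed
  then have "Z \<in> vector_fields A" using Z_tangent by (simp add: vector_fields_def)
  moreover have "Z p = w" using p b(2) by (simp add: Z_def e tscale_def)
  ultimately show ?thesis using that by blast
qed

section \<open>The algebra of the twin interchange\<close>

lemma additive_on_uminus:
  fixes f :: "'v::ab_group_add \<Rightarrow> 'w::ab_group_add"
  assumes "0 \<in> V" "\<And>a. a \<in> V \<Longrightarrow> - a \<in> V"
    and f: "\<And>a b. a \<in> V \<Longrightarrow> b \<in> V \<Longrightarrow> f (a + b) = f a + f b" and a: "a \<in> V"
  shows "f (- a) = - f a"
proof -
  have "f 0 = 0" using f[OF assms(1,1)] by simp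
  then show ?thesis using f[OF a assms(2)[OF a]] by (simp add: eq_neg_iff_add_eq_0 add.commute)
qed

text \<open>Here \<open>V\<close> stands for the vector fields and \<open>G\<close> for the metric evaluated at one fixed point. The two
  metric conditions enter only through \<open>compat\<close>, which equates the two ways to differentiate
  \<open>G (J y) z\<close> along \<open>x\<close>; this removes functions and their derivatives from the argument.\<close>

lemma twin_assoc_nijenhuis_sum_orthogonal:
  fixes V :: "'v::ab_group_add set" and J :: "'v \<Rightarrow> 'v" and D D' :: "'v \<Rightarrow> 'v \<Rightarrow> 'v"
    and G :: "'v \<Rightarrow> 'v \<Rightarrow> real"
  assumes V: "\<And>x y. x \<in> V \<Longrightarrow> y \<in> V \<Longrightarrow> x + y \<in> V" "\<And>x. x \<in> V \<Longrightarrow> - x \<in> V"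
    and JV: "\<And>x. x \<in> V \<Longrightarrow> J x \<in> V"
    and J_add: "\<And>x y. x \<in> V \<Longrightarrow> y \<in> V \<Longrightarrow> J (x + y) = J x + J y"
    and JJ: "\<And>x. x \<in> V \<Longrightarrow> J (J x) = - x"
    and DV: "\<And>x y. x \<in> V \<Longrightarrow> y \<in> V \<Longrightarrow> D x y \<in> V"
    and D'V: "\<And>x y. x \<in> V \<Longrightarrow> y \<in> V \<Longrightarrow> D' x y \<in> V"
    and D_add: "\<And>x y z. x \<in> V \<Longrightarrow> y \<in> V \<Longrightarrow> z \<in> V \<Longrightarrow> D x (y + z) = D x y + D x z"
    and tor: "\<And>x y. x \<in> V \<Longrightarrow> y \<in> V \<Longrightarrow> D x y - D y x = D' x y - D' y x"
    and G_add: "\<And>x y z. x \<in> V \<Longrightarrow> y \<in> V \<Longrightarrow> z \<in> V \<Longrightarrow> G (x + y) z = G x z + G y z"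
    and G_sym: "\<And>x y. x \<in> V \<Longrightarrow> y \<in> V \<Longrightarrow> G x y = G y x"
    and G_J: "\<And>x y. x \<in> V \<Longrightarrow> y \<in> V \<Longrightarrow> G (J x) (J y) = - G x y"
    and compat: "\<And>x y z. x \<in> V \<Longrightarrow> y \<in> V \<Longrightarrow> z \<in> V \<Longrightarrow>
      G (D x (J y)) z + G (J y) (D x z) = G (J (D' x y)) z + G (J y) (D' x z)"
    and x: "x \<in> V" and y: "y \<in> V" and z: "z \<in> V"
  defines "N \<equiv> \<lambda>D. (D (J x) (J y) + D (J y) (J x)) - (D x y + D y x)
      - J (D (J x) y + D y (J x)) - J (D x (J y) + D (J y) x)"
  shows "G (N D + N D') z = 0"
proof -
  have zV: "0 \<in> V" using V(1)[OF x V(2)[OF x]] by simp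
  have diffV: "a - b \<in> V" if "a \<in> V" "b \<in> V" for a b using V(1)[OF that(1) V(2)[OF that(2)]] by simp
  note cl = V diffV JV DV D'V x y z
  have J_min: "J (- a) = - J a" if "a \<in> V" for a by (rule additive_on_uminus[OF zV V(2) J_add that])
  have D_min: "D b (- a) = - D b a" if "a \<in> V" "b \<in> V" for a b
    by (rule additive_on_uminus[OF zV V(2) D_add[OF that(2)] that(1)])
  have G_min: "G (- a) c = - G a c" if "a \<in> V" "c \<in> V" for a c
    by (rule additive_on_uminus[where f = "\<lambda>a. G a c", OF zV V(2) G_add[OF _ _ that(2)] that(1)])
  have G_min2: "G c (- a) = - G c a" if "a \<in> V" "c \<in> V" for a c
    using G_min[OF that] G_sym that V(2) by metis
  have J_diff: "J (a - b) = J a - J b" if "a \<in> V" "b \<in> V" for a b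
    using J_add[OF that(1) V(2)[OF that(2)]] J_min[OF that(2)] by simp
  have G_diff: "G (a - b) c = G a c - G b c" if "a \<in> V" "b \<in> V" "c \<in> V" for a b c
    using G_add[OF that(1) V(2)[OF that(2)] that(3)] G_min[OF that(2,3)] by simp
  \<comment> \<open>\<open>J\<close> is symmetric for \<open>G\<close>, which is the Norden condition with \<open>J\<^sup>2 = - 1\<close>.\<close>
  have G_Jr: "G a (J b) = G (J a) b" if "a \<in> V" "b \<in> V" for a b
    using G_J[OF that(1) JV[OF that(2)]] JJ[OF that(2)] G_min2[OF that(2) JV[OF that(1)]] by simp
  define P where "P = (\<lambda>a b. D' a b - D a b)"
  have PV: "P a b \<in> V" if "a \<in> V" "b \<in> V" for a b using that by (simp add: P_def cl)
  have P_sym: "P a b = P b a" if "a \<in> V" "b \<in> V" for a b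
    using tor[OF that] by (simp add: P_def algebra_simps)
  define T where "T = (\<lambda>a b c. G (J (P a b)) c)"
  define F where "F = (\<lambda>a b c. G (D a (J b)) c - G (J (D a b)) c)"
  have T_sym: "T a b c = T b a c" if "a \<in> V" "b \<in> V" for a b c
    using P_sym[OF that] by (simp add: T_def)
  have F_T: "F a b c = T a b c + T a c b" if "a \<in> V" "b \<in> V" "c \<in> V" for a b c
  proof -
    have "T a c b = G (P a c) (J b)"
      using that G_Jr[OF PV[OF that(1,3)] that(2)] by (simp add: T_def)
    also have "\<dots> = G (J b) (D' a c) - G (J b) (D a c)"
      using G_diff[OF _ _ JV[OF that(2)]] G_sym[OF _ JV[OF that(2)]] that
      by (simp add: P_def cl)
    finally show ?thesis
      using compat[OF that] that by (simp add: F_def T_def P_def J_diff G_diff cl)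
  qed
  \<comment> \<open>Koszul's trick: in the cyclic combination only the symmetric term survives.\<close>
  have T_F: "2 * T a b c = F a b c + F b a c - F c a b" if "a \<in> V" "b \<in> V" "c \<in> V" for a b c
    using F_T T_sym that by simp
  \<comment> \<open>\<open>D\<^sub>x J\<close> anticommutes with \<open>J\<close>, as one sees by differentiating \<open>J\<^sup>2 = - 1\<close>.\<close>
  have F_J: "F a (J b) c = - F a b (J c)" if "a \<in> V" "b \<in> V" "c \<in> V" for a b c
    using that by (simp add: F_def JJ D_min G_min G_Jr cl)
  have F_min: "F a b (- c) = - F a b c" if "a \<in> V" "b \<in> V" "c \<in> V" for a b c
    using that by (simp add: F_def G_min2 cl)
  have closed: "\<forall>a\<in>V. \<forall>b\<in>V. D a b \<in> V" "\<forall>a\<in>V. \<forall>b\<in>V. D' a b \<in> V"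
    using DV D'V by blast+
  have GN: "G (N E) z = G (E (J x) (J y)) z + G (E (J y) (J x)) z - G (E x y) z - G (E y x) z
      - G (J (E (J x) y)) z - G (J (E y (J x))) z - G (J (E x (J y))) z - G (J (E (J y) x)) z"
    if "\<forall>a\<in>V. \<forall>b\<in>V. E a b \<in> V" for E
    unfolding N_def by (simp add: that cl J_add G_add G_diff)
  have NV: "N E \<in> V" if "\<forall>a\<in>V. \<forall>b\<in>V. E a b \<in> V" for E
    unfolding N_def by (simp add: that cl)
  have GP: "G (D' a b) c - G (D a b) c = - T a b (J c)" if "a \<in> V" "b \<in> V" "c \<in> V" for a b c
    using that G_J[OF PV[OF that(1,2)] that(3)] by (simp add: T_def P_def G_diff cl)
  have GJP: "G (J (D' a b)) c - G (J (D a b)) c = T a b c" if "a \<in> V" "b \<in> V" "c \<in> V" for a b c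
    using that by (simp add: T_def P_def J_diff G_diff cl)
  \<comment> \<open>\<open>N\<close> is linear in the connection, so the difference is \<open>N\<close> of the symmetric \<open>P = D' - D\<close>.\<close>
  have change: "G (N D') z - G (N D) z =
      2 * (T x y (J z) - T (J x) (J y) (J z) - T (J x) y z - T x (J y) z)"
  proof -
    have "G (N D') z - G (N D) z = - T (J x) (J y) (J z) - T (J y) (J x) (J z) + T x y (J z)
        + T y x (J z) - T (J x) y z - T y (J x) z - T x (J y) z - T (J y) x z"
      unfolding GN[OF closed(1)] GN[OF closed(2)]
      using GP[OF JV[OF x] JV[OF y] z] GP[OF JV[OF y] JV[OF x] z] GP[OF x y z] GP[OF y x z]
        GJP[OF JV[OF x] y z] GJP[OF y JV[OF x] z] GJP[OF x JV[OF y] z] GJP[OF JV[OF y] x z]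
      by linarith
    then show ?thesis using T_sym cl by simp
  qed
  have GND: "G (N D) z = F (J x) y z + F (J y) x z - F x y (J z) - F y x (J z)"
    unfolding GN[OF closed(1)] by (simp add: F_def G_Jr JJ G_min cl)
  have "G (N D') z - G (N D) z = - 2 * G (N D) z"
    unfolding change unfolding GND
    using T_F[OF x y JV[OF z]] T_F[OF JV[OF x] JV[OF y] JV[OF z]] T_F[OF JV[OF x] y z] T_F[OF x JV[OF y] z]
    by (simp add: F_J JJ F_min cl)
  then show ?thesis using G_add[OF NV[OF closed(1)] NV[OF closed(2)] z] by simp
qed

section \<open>Invariance under the twin interchange\<close>

theorem proposition2p7:
  fixes A :: "('a::{t2_space,second_countable_topology}, 'e::euclidean_space) chart set"
    and J :: "'a endo_field"
    and g :: "'a bilin_field"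
    and D D' :: "'a connection"
    and n :: nat
  assumes "norden_manifold n A J g"
    and "levi_civita A g D"
    and "levi_civita A (assoc_metric J g) D'"
  shows "\<forall>x\<in>vector_fields A. \<forall>y\<in>vector_fields A.
           nijenhuis J D x y = nijenhuis J D' x y \<and>
           assoc_nijenhuis J D x y = - assoc_nijenhuis J D' x y"
proof (intro ballI conjI)
  fix x y assume x: "x \<in> vector_fields A" and y: "y \<in> vector_fields A"
  let ?V = "vector_fields A"
  have A: "smooth_atlas A" and ac: "almost_complex A J" and pr: "pseudo_riemannian A g"
    and norden: "\<And>p v w. v \<in> tangent_space A p \<Longrightarrow> w \<in> tangent_space A p \<Longrightarrow>
      g p (J p v) (J p w) = - g p v w"
    using assms(1) unfolding norden_manifold_def by blast+
  have se: "smooth_endo_field A J"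
    and JJ: "\<And>p v. v \<in> tangent_space A p \<Longrightarrow> J p (J p v) = - v"
    using ac unfolding almost_complex_def by blast+
  have J_add: "\<And>p v w. v \<in> tangent_space A p \<Longrightarrow> w \<in> tangent_space A p \<Longrightarrow>
      J p (v + w) = J p v + J p w"
    and JV: "\<And>X. X \<in> ?V \<Longrightarrow> endo J X \<in> ?V"
    using se unfolding smooth_endo_field_def by blast+
  have g_sym: "\<And>p v w. v \<in> tangent_space A p \<Longrightarrow> w \<in> tangent_space A p \<Longrightarrow> g p v w = g p w v"
    and g_add: "\<And>p u v w. u \<in> tangent_space A p \<Longrightarrow> v \<in> tangent_space A p \<Longrightarrow>
      w \<in> tangent_space A p \<Longrightarrow> g p (u + v) w = g p u w + g p v w"
    and g_nondeg: "\<And>p v. v \<in> tangent_space A p \<Longrightarrow>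
      (\<And>w. w \<in> tangent_space A p \<Longrightarrow> g p v w = 0) \<Longrightarrow> v = 0"
    using pr unfolding pseudo_riemannian_def by blast+
  have aff: "affine_connection A D" "affine_connection A D'"
    and tor: "\<And>X Y. X \<in> ?V \<Longrightarrow> Y \<in> ?V \<Longrightarrow> D X Y - D Y X = lie_bracket A X Y"
      "\<And>X Y. X \<in> ?V \<Longrightarrow> Y \<in> ?V \<Longrightarrow> D' X Y - D' Y X = lie_bracket A X Y"
    and D_metric: "\<And>X Y Z. X \<in> ?V \<Longrightarrow> Y \<in> ?V \<Longrightarrow> Z \<in> ?V \<Longrightarrow>
      vapply X (bilin g Y Z) = bilin g (D X Y) Z + bilin g Y (D X Z)"
    and D'_metric: "\<And>X Y Z. X \<in> ?V \<Longrightarrow> Y \<in> ?V \<Longrightarrow> Z \<in> ?V \<Longrightarrow>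
      vapply X (bilin (assoc_metric J g) Y Z) =
      bilin (assoc_metric J g) (D' X Y) Z + bilin (assoc_metric J g) Y (D' X Z)"
    using assms(2,3) unfolding levi_civita_def by blast+
  have DV: "\<And>X Y. X \<in> ?V \<Longrightarrow> Y \<in> ?V \<Longrightarrow> D X Y \<in> ?V"
      "\<And>X Y. X \<in> ?V \<Longrightarrow> Y \<in> ?V \<Longrightarrow> D' X Y \<in> ?V"
    and D_add: "\<And>X Y Z. X \<in> ?V \<Longrightarrow> Y \<in> ?V \<Longrightarrow> Z \<in> ?V \<Longrightarrow> D X (Y + Z) = D X Y + D X Z"
    using aff unfolding affine_connection_def by blast+
  note tangent = vector_fields_tangent

  have "comm_bracket D X Y = comm_bracket D' X Y" if "X \<in> ?V" "Y \<in> ?V" for X Y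
    using tor that by (simp add: comm_bracket_def)
  then show "nijenhuis J D x y = nijenhuis J D' x y"
    using x y JV by (simp add: nijenhuis_def)

  let ?S = "assoc_nijenhuis J D x y + assoc_nijenhuis J D' x y"
  have SV: "?S \<in> ?V"
    unfolding assoc_nijenhuis_def sym_bracket_def
    by (intro vector_fields_add vector_fields_diff A JV DV x y)
  have "?S p = 0" for p
  proof (rule g_nondeg[OF tangent[OF SV]])
    fix w assume "w \<in> tangent_space A p"
    \<comment> \<open>Metric compatibility speaks of vector fields, so \<open>w\<close> has to be extended to one.\<close>
    then obtain Z where Z: "Z \<in> ?V" "Z p = w" using tangent_vector_extends[OF A] by metis
    have "bilin g ?S Z p = 0"
      unfolding assoc_nijenhuis_def sym_bracket_def
    proof (rule twin_assoc_nijenhuis_sum_orthogonal[where V = ?V and J = "endo J" and D = D and D' = D'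
          and G = "\<lambda>X Y. bilin g X Y p"])
      show "bilin g (D X (endo J Y)) W p + bilin g (endo J Y) (D X W) p =
          bilin g (endo J (D' X Y)) W p + bilin g (endo J Y) (D' X W) p"
        if "X \<in> ?V" "Y \<in> ?V" "W \<in> ?V" for X Y W
      proof -
        have *: "bilin (assoc_metric J g) X Y = bilin g (endo J X) Y" for X Y
          by (simp add: bilin_def assoc_metric_def endo_def)
        show ?thesis
          using fun_cong[OF D_metric[OF that(1) JV[OF that(2)] that(3)], of p]
            fun_cong[OF D'_metric[OF that], of p]
          unfolding * by simp
      qed
      show "endo J (X + Y) = endo J X + endo J Y" if "X \<in> ?V" "Y \<in> ?V" for X Y
        by (rule ext) (simp add: endo_def J_add tangent that, simp add: fun_eq_iff)
      show "endo J (endo J X) = - X" if "X \<in> ?V" for X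
        by (rule ext) (simp add: endo_def JJ tangent that, simp add: fun_eq_iff)
      show "D X Y - D Y X = D' X Y - D' Y X" if "X \<in> ?V" "Y \<in> ?V" for X Y
        using tor that by simp
      show "bilin g (X + Y) W p = bilin g X W p + bilin g Y W p"
        if "X \<in> ?V" "Y \<in> ?V" "W \<in> ?V" for X Y W
        using g_add[OF tangent[OF that(1)] tangent[OF that(2)] tangent[OF that(3)]]
        by (simp add: bilin_def)
      show "bilin g X Y p = bilin g Y X p" if "X \<in> ?V" "Y \<in> ?V" for X Y
        using g_sym[OF tangent[OF that(1)] tangent[OF that(2)]] by (simp add: bilin_def)
      show "bilin g (endo J X) (endo J Y) p = - bilin g X Y p" if "X \<in> ?V" "Y \<in> ?V" for X Y
        using norden[OF tangent[OF that(1)] tangent[OF that(2)]] by (simp add: bilin_def endo_def)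
    qed (fact vector_fields_add[OF A] vector_fields_uminus[OF A] JV DV D_add x y Z(1))+
    then show "g p (?S p) w = 0" using Z(2) by (simp add: bilin_def)
  qed
  then have "?S = 0" by (simp add: fun_eq_iff)
  then show "assoc_nijenhuis J D x y = - assoc_nijenhuis J D' x y"
    by (simp add: eq_neg_iff_add_eq_0)
qed

end
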